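(* For any positive integer $k$, the automorphism group of the directed graph $G(k,1,1)$ is isomorphic to the symmetric group $S_k$.
   Context: For a positive integer $k$ and an element $w$ of multiplicative order $c$ in $\mathbb{Z}/k\mathbb{Z}$ (so $w$ is a unit mod $k$) with $c\mid k$, the directed graph $G(k,c,w)$ (loops allowed) has vertex set $\mathbb{Z}/k\mathbb{Z}\times\mathbb{Z}/k\mathbb{Z}$, and its edges are all the directed edges $(p,i)\to(p+w^j i,\,j)$ with $p,i,j\in\mathbb{Z}/k\mathbb{Z}$. In particular $G(k,1,1)$ has edges $(p,i)\to(p+i,j)$ for all $p,i,j\in\mathbb{Z}/k\mathbb{Z}$. *)

theory Defs
  imports
    "HOL-Number_Theory.Number_Theory"
    "HOL-Algebra.Algebra"
    "Graph_Theory.Pair_Digraph"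
begin

text \<open>
  The residue ring modulo \<open>k\<close> is represented by \<open>{..<k}\<close> with arithmetic modulo \<open>k\<close>.
  The parameter \<open>w\<close> may be any natural number representing the given residue class
  (so \<open>w = 1\<close> is allowed for \<open>k = 1\<close>).
\<close>

definition G_params :: "nat \<Rightarrow> nat \<Rightarrow> nat \<Rightarrow> bool" where
  "G_params k c w \<longleftrightarrow> 0 < k \<and> coprime k w \<and> ord k w = c \<and> c dvd k"

text \<open>
  The order \<open>c\<close> of \<open>w\<close> is determined by \<open>k\<close> and \<open>w\<close> and does not occur in the edge rule; it is
  kept as an argument to follow the notation \<open>G(k,c,w)\<close>. By \<open>G_params_power_cong\<close> below,
  the condition \<open>c dvd k\<close> makes \<open>w ^ j\<close> depend only on the residue class of the exponent.
\<close>

definition G_digraph :: "nat \<Rightarrow> nat \<Rightarrow> nat \<Rightarrow> (nat \<times> nat) pair_pre_digraph" where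
  "G_digraph k c w =
    \<lparr> pverts = {..<k} \<times> {..<k},
      parcs = {((p, i), ((p + w ^ j * i) mod k, j)) | p i j. p < k \<and> i < k \<and> j < k} \<rparr>"

definition digraph_auts :: "'a pair_pre_digraph \<Rightarrow> ('a \<Rightarrow> 'a) set" where
  "digraph_auts G =
    {f \<in> Bij (pverts G). \<forall>u\<in>pverts G. \<forall>v\<in>pverts G. (u, v) \<in> parcs G \<longleftrightarrow> (f u, f v) \<in> parcs G}"

definition digraph_AutGroup :: "'a pair_pre_digraph \<Rightarrow> ('a \<Rightarrow> 'a) monoid" where
  "digraph_AutGroup G = BijGroup (pverts G) \<lparr>carrier := digraph_auts G\<rparr>"

lemma G_params_1_1: "0 < k \<Longrightarrow> G_params k 1 1"
  by (simp add: G_params_def ord_def cong_def Least_equality Suc_le_eq)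

lemma G_params_power_cong:
  assumes "G_params k c w" and "[j = j'] (mod k)"
  shows "[w ^ j = w ^ j'] (mod k)"
  using assms order_divides_expdiff[of k w j j'] cong_dvd_modulus_nat[of j j' k c]
  by (auto simp: G_params_def)

lemma G_digraph_wf: "pair_fin_digraph (G_digraph k c w)"
proof
  show "finite (parcs (G_digraph k c w))"
    by (rule finite_subset[of _ "({..<k} \<times> {..<k}) \<times> ({..<k} \<times> {..<k})"])
      (auto simp: G_digraph_def)
qed (auto simp: G_digraph_def)

lemma group_digraph_AutGroup: "group (digraph_AutGroup G)"
proof -
  let ?V = "pverts G"
  have "subgroup (digraph_auts G) (BijGroup ?V)"
  proof (rule subgroup.intro)
    show "digraph_auts G \<subseteq> carrier (BijGroup ?V)"
      by (auto simp: digraph_auts_def BijGroup_def)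
  next
    fix x y assume "x \<in> digraph_auts G" "y \<in> digraph_auts G"
    moreover from this have "y u \<in> ?V" if "u \<in> ?V" for u
      using that by (auto simp: digraph_auts_def dest: Bij_imp_funcset)
    ultimately show "x \<otimes>\<^bsub>BijGroup ?V\<^esub> y \<in> digraph_auts G"
      by (simp add: digraph_auts_def BijGroup_def compose_Bij compose_eq)
  next
    show "\<one>\<^bsub>BijGroup ?V\<^esub> \<in> digraph_auts G"
      by (simp add: digraph_auts_def BijGroup_def id_Bij)
  next
    fix x assume x: "x \<in> digraph_auts G"
    then have B: "x \<in> Bij ?V" by (simp add: digraph_auts_def)
    have inv_mem: "inv_into ?V x u \<in> ?V" and inv_eq: "x (inv_into ?V x u) = u" if "u \<in> ?V" for u
      using B that by (auto simp: Bij_def bij_betw_def inv_into_into f_inv_into_f)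
    show "inv\<^bsub>BijGroup ?V\<^esub> x \<in> digraph_auts G"
      using x inv_mem inv_eq
      by (simp add: digraph_auts_def inv_BijGroup B restrict_inv_into_Bij)
  qed
  then show ?thesis
    unfolding digraph_AutGroup_def by (rule subgroup.subgroup_is_group[OF _ group_BijGroup])
qed

end

theory Submission
  imports Defs
begin

text \<open>
  The graph \<open>G(k,1,1)\<close> is a de Bruijn graph in disguise.  Replacing the coordinate \<open>i\<close> of a
  vertex by \<open>q = p + i\<close> turns the vertices into all two-letter words \<open>(p, q)\<close>, and the edges
  become \<open>(p, q) \<rightarrow> (q, r)\<close>: the last letter of the first word is the first letter of the
  second.  Every permutation of the letters then acts on the words and preserves the edges.

  Conversely, an automorphism \<open>g\<close> comes from a permutation of the letters.  The vertices with a
  loop are exactly the constant words, so \<open>g (a, a) = (s a, s a)\<close> for some map \<open>s\<close>.  The word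
  \<open>(a, b)\<close> lies on the path \<open>(a, a) \<rightarrow> (a, b) \<rightarrow> (b, b)\<close>, so its image starts with the last letter
  of \<open>g (a, a)\<close> and ends with the first letter of \<open>g (b, b)\<close>; that is,
  \<open>g (a, b) = (s a, s b)\<close>.  Since \<open>g\<close> is bijective, so is \<open>s\<close>.  The lemma
  \<open>letter_permutations_iso_auts\<close> carries out this argument for any digraph whose vertices
  are encoded by all two-letter words and whose arcs are the overlaps of words;
  \<open>bij_betw_word\<close> and \<open>arc_iff_words_overlap\<close> supply the encoding for \<open>G(k,1,1)\<close>.
\<close>

text \<open>
  Outside \<open>V\<close> the value is \<open>undefined\<close>, since the elements of \<open>BijGroup V\<close> are extensional.
\<close>

definition act_on_words ::
    "('v \<Rightarrow> 'l \<times> 'l) \<Rightarrow> 'v set \<Rightarrow> ('l \<Rightarrow> 'l) \<Rightarrow> 'v \<Rightarrow> 'v" where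
  "act_on_words e V s = (\<lambda>u\<in>V. inv_into V e (map_prod s s (e u)))"

lemma act_on_words_vertex:
  assumes e: "bij_betw e V (L \<times> L)" and s: "\<And>a. a \<in> L \<Longrightarrow> s a \<in> L" and u: "u \<in> V"
  shows "act_on_words e V s u \<in> V" "e (act_on_words e V s u) = map_prod s s (e u)"
proof -
  have "e u \<in> L \<times> L" using e u by (auto dest: bij_betwE)
  then have "map_prod s s (e u) \<in> e ` V"
    using s e by (auto simp: bij_betw_def)
  then show "act_on_words e V s u \<in> V" "e (act_on_words e V s u) = map_prod s s (e u)"
    using u by (auto simp: act_on_words_def inv_into_into f_inv_into_f)
qed

lemma act_on_words_comp:
  assumes e: "bij_betw e V (L \<times> L)" and "\<And>a. a \<in> L \<Longrightarrow> s a \<in> L" "\<And>a. a \<in> L \<Longrightarrow> t a \<in> L"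
  shows "act_on_words e V (s \<circ> t) = compose V (act_on_words e V s) (act_on_words e V t)"
  using act_on_words_vertex[OF e, of t]
  by (auto simp: act_on_words_def[of e V "s \<circ> t"] act_on_words_def[of e V s] compose_def
      fun_eq_iff assms map_prod_compose)

lemma act_on_words_automorphism:
  assumes e: "bij_betw e (pverts G) (L \<times> L)"
    and arcs: "\<And>u v. u \<in> pverts G \<Longrightarrow> v \<in> pverts G \<Longrightarrow>
      (u, v) \<in> parcs G \<longleftrightarrow> snd (e u) = fst (e v)"
    and s: "s permutes L"
  shows "act_on_words e (pverts G) s \<in> digraph_auts G"
proof -
  let ?V = "pverts G" and ?A = "act_on_words e (pverts G) s"
  have sL: "s a \<in> L" if "a \<in> L" for a using s that by (simp add: permutes_in_image)
  note A = act_on_words_vertex[OF e sL]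
  have "bij_betw (map_prod s s) (L \<times> L) (L \<times> L)"
    using s by (intro bij_betw_map_prod) (auto simp: permutes_imp_bij)
  then have "bij_betw (inv_into ?V e \<circ> (map_prod s s \<circ> e)) ?V ?V"
    using e by (meson bij_betw_inv_into bij_betw_trans)
  then have "bij_betw ?A ?V ?V"
    by (rule bij_betw_cong[THEN iffD1, rotated]) (simp add: act_on_words_def)
  then have "?A \<in> Bij ?V" by (simp add: Bij_def act_on_words_def)
  moreover have "(u, v) \<in> parcs G \<longleftrightarrow> (?A u, ?A v) \<in> parcs G" if "u \<in> ?V" "v \<in> ?V" for u v
    using that by (simp add: arcs A inj_eq[OF permutes_inj[OF s]])
  ultimately show ?thesis by (simp add: digraph_auts_def)
qed

text \<open>
  The letter permutation is read off from the loops; the path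
  \<open>(a, a) \<rightarrow> (a, b) \<rightarrow> (b, b)\<close> then determines the images of all other words.
\<close>

lemma automorphism_from_letter_permutation:
  assumes e: "bij_betw e (pverts G) (L \<times> L)"
    and arcs: "\<And>u v. u \<in> pverts G \<Longrightarrow> v \<in> pverts G \<Longrightarrow>
      (u, v) \<in> parcs G \<longleftrightarrow> snd (e u) = fst (e v)"
    and g: "g \<in> digraph_auts G"
  obtains s where "s permutes L" "g = act_on_words e (pverts G) s"
proof -
  let ?V = "pverts G"
  define d where "d = inv_into ?V e"
  have dV: "d (a, b) \<in> ?V" and ed: "e (d (a, b)) = (a, b)" if "a \<in> L" "b \<in> L" for a b
    using e that by (auto simp: d_def bij_betw_def inv_into_into f_inv_into_f)
  have de: "d (e u) = u" if "u \<in> ?V" for u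
    using e that by (simp add: d_def bij_betw_def)
  have g_bij: "bij_betw g ?V ?V" and g_ext: "g \<in> extensional ?V"
    using g by (auto simp: digraph_auts_def Bij_def)
  have g_arcs: "(g u, g v) \<in> parcs G \<longleftrightarrow> (u, v) \<in> parcs G" if "u \<in> ?V" "v \<in> ?V" for u v
    using g that by (simp add: digraph_auts_def)
  have gV: "g u \<in> ?V" if "u \<in> ?V" for u using bij_betwE[OF g_bij] that by blast
  have step: "snd (e (g (d (a, b)))) = fst (e (g (d (b, c))))"
    if "a \<in> L" "b \<in> L" "c \<in> L" for a b c
    using g_arcs[of "d (a, b)" "d (b, c)"] that by (simp add: arcs dV ed gV)
  \<comment> \<open>Permutations of \<open>L\<close> are total functions that fix everything outside \<open>L\<close>.\<close>
  define s where "s = (\<lambda>a. if a \<in> L then fst (e (g (d (a, a)))) else a)"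
  have gd: "e (g (d (a, b))) = (s a, s b)" if "a \<in> L" "b \<in> L" for a b
    using step[of a a b] step[of a b b] step[of a a a] that
    by (simp add: s_def prod_eq_iff)
  have g_eq: "g u = act_on_words e ?V s u" for u
  proof (cases "u \<in> ?V")
    case True
    obtain a b where ab: "e u = (a, b)" by (cases "e u")
    then have "a \<in> L" "b \<in> L" using e True by (auto dest!: bij_betwE)
    then have "e (g u) = (s a, s b)" using gd[of a b] de[OF True] ab by simp
    then have "g u = d (s a, s b)" using de[OF gV[OF True]] by simp
    then show ?thesis using True ab by (simp add: act_on_words_def d_def)
  next
    case False
    then show ?thesis using extensional_arb[OF g_ext] by (simp add: act_on_words_def)
  qed
  have "bij_betw s L L"
    unfolding bij_betw_def
  proof (intro conjI)
    show "inj_on s L"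
    proof (rule inj_onI)
      fix a b assume ab: "a \<in> L" "b \<in> L" "s a = s b"
      have "inj_on (e \<circ> g) ?V"
        using e g_bij by (metis bij_betw_imp_inj_on bij_betw_trans)
      then have "d (a, a) = d (b, b)"
        by (rule inj_onD) (use ab in \<open>simp_all add: gd dV\<close>)
      then have "e (d (a, a)) = e (d (b, b))" by (rule arg_cong)
      then show "a = b" using ab(1,2) by (simp add: ed)
    qed
    show "s ` L = L"
    proof
      show "s ` L \<subseteq> L"
      proof
        fix c assume "c \<in> s ` L"
        then obtain a where a: "a \<in> L" "c = s a" by auto
        then have "e (g (d (a, a))) \<in> L \<times> L" using bij_betwE[OF e] gV dV by blast
        then show "c \<in> L" using a by (simp add: gd)
      qed
      show "L \<subseteq> s ` L"
      proof
        fix c assume c: "c \<in> L"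
        then have "d (c, c) \<in> g ` ?V" using g_bij dV by (simp add: bij_betw_def)
        then obtain u where u: "u \<in> ?V" "g u = d (c, c)" by auto
        obtain a b where ab: "e u = (a, b)" by (cases "e u")
        then have L: "a \<in> L" "b \<in> L" using e u by (auto dest!: bij_betwE)
        then have "c = s a"
          using gd[OF L] ed[OF c c] de[OF u(1)] u(2) by (simp add: ab)
        then show "c \<in> s ` L" using L by auto
      qed
    qed
  qed
  then have "s permutes L" by (rule bij_imp_permutes) (simp add: s_def)
  then show thesis using that ext[of g, OF g_eq] by blast
qed

lemma letter_permutations_iso_auts:
  assumes e: "bij_betw e (pverts G) (L \<times> L)"
    and arcs: "\<And>u v. u \<in> pverts G \<Longrightarrow> v \<in> pverts G \<Longrightarrow>
      (u, v) \<in> parcs G \<longleftrightarrow> snd (e u) = fst (e v)"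
  shows "act_on_words e (pverts G)
    \<in> iso \<lparr>carrier = {s. s permutes L}, mult = (\<circ>), one = id\<rparr> (digraph_AutGroup G)"
proof -
  let ?V = "pverts G" and ?A = "act_on_words e (pverts G)"
  have auts: "?A s \<in> digraph_auts G" if "s permutes L" for s
    using act_on_words_automorphism[OF e] arcs that by blast
  have "inj_on ?A {s. s permutes L}"
  proof (rule inj_onI, rule ext)
    fix s t a assume st: "s \<in> {s. s permutes L}" "t \<in> {s. s permutes L}" "?A s = ?A t"
    show "s a = t a"
    proof (cases "a \<in> L")
      case True
      then have "(a, a) \<in> e ` ?V" using e by (simp add: bij_betw_def)
      then obtain u where u: "u \<in> ?V" "e u = (a, a)" by auto
      have "e (?A s u) = (s a, s a)" "e (?A t u) = (t a, t a)"
        using act_on_words_vertex(2)[OF e _ u(1), of s] act_on_words_vertex(2)[OF e _ u(1), of t]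
          st(1,2) by (simp_all add: permutes_in_image u(2))
      then show ?thesis using st(3) by simp
    next
      case False
      then show ?thesis using st by (simp add: permutes_not_in)
    qed
  qed
  moreover have "?A ` {s. s permutes L} = digraph_auts G"
    using auts automorphism_from_letter_permutation[OF e arcs] by blast
  moreover have "?A (s \<circ> t) = ?A s \<otimes>\<^bsub>digraph_AutGroup G\<^esub> ?A t"
    if "s permutes L" "t permutes L" for s t
    using that auts[of s] auts[of t] act_on_words_comp[OF e, of s t]
    by (simp add: digraph_AutGroup_def BijGroup_def digraph_auts_def permutes_in_image)
  ultimately show ?thesis
    using auts by (auto simp: iso_def hom_def bij_betw_def digraph_AutGroup_def)
qed

text \<open>Letters are shifted by one because \<open>sym_group k\<close> permutes \<open>{1..k}\<close>.\<close>

definition word :: "nat \<Rightarrow> nat \<times> nat \<Rightarrow> nat \<times> nat" where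
  "word k = (\<lambda>(p, i). (Suc p, Suc ((p + i) mod k)))"

lemma bij_betw_word:
  assumes "0 < k"
  shows "bij_betw (word k) ({..<k} \<times> {..<k}) ({1..k} \<times> {1..k})"
proof -
  have inj: "inj_on (word k) ({..<k} \<times> {..<k})"
  proof (rule inj_onI)
    fix u v assume uv: "u \<in> {..<k} \<times> {..<k}" "v \<in> {..<k} \<times> {..<k}" "word k u = word k v"
    obtain p i q j where [simp]: "u = (p, i)" "v = (q, j)" by (cases u, cases v)
    have "q = p" and "[p + i = p + j] (mod k)"
      using uv by (auto simp: word_def cong_def)
    then show "u = v"
      using uv cong_add_lcancel_nat[of p i j k] by (simp add: cong_def)
  qed
  have sub: "word k ` ({..<k} \<times> {..<k}) \<subseteq> {1..k} \<times> {1..k}"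
    using assms by (auto simp: word_def Suc_le_eq)
  \<comment> \<open>An injection between finite sets of the same size is onto.\<close>
  have "word k ` ({..<k} \<times> {..<k}) = {1..k} \<times> {1..k}"
    using sub by (rule card_subset_eq[rotated]) (simp_all add: card_image inj)
  with inj show ?thesis by (simp add: bij_betw_def)
qed

lemma arc_iff_words_overlap:
  assumes "u \<in> pverts (G_digraph k 1 1)" "v \<in> pverts (G_digraph k 1 1)"
  shows "(u, v) \<in> parcs (G_digraph k 1 1) \<longleftrightarrow> snd (word k u) = fst (word k v)"
  using assms by (auto simp: G_digraph_def word_def)

theorem theorem5:
  fixes k :: nat
  assumes "0 < k"
  shows "digraph_AutGroup (G_digraph k 1 1) \<cong> sym_group k"
proof -
  have "bij_betw (word k) (pverts (G_digraph k 1 1)) ({1..k} \<times> {1..k})"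
    using bij_betw_word[OF assms] by (simp add: G_digraph_def)
  then have "sym_group k \<cong> digraph_AutGroup (G_digraph k 1 1)"
    using letter_permutations_iso_auts[OF _ arc_iff_words_overlap]
    unfolding is_iso_def sym_group_def by blast
  then show ?thesis
    by (rule group.iso_sym[OF sym_group_is_group])
qed

end
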